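(* There are infinitely many rational Diophantine sextuples that contain a strong Diophantine pair.
   Context: A rational Diophantine $m$-tuple is a set of $m$ distinct nonzero rationals $\{a_1,\dots,a_m\}$ such that $a_ia_j+1$ is a square of a rational number for all $1\le i<j\le m$. A strong Diophantine pair is a rational Diophantine pair $\{a,b\}$ such that $a^2+1$ and $b^2+1$ are also rational squares. A sextuple contains a strong Diophantine pair if two of its elements form a strong Diophantine pair. *)

theory Defs
  imports Complex_Main "HOL-Computational_Algebra.Nth_Powers"
begin

definition rational_diophantine_tuple :: "nat \<Rightarrow> rat set \<Rightarrow> bool" where
  "rational_diophantine_tuple m S \<longleftrightarrow>
     finite S \<and> card S = m \<and> 0 \<notin> S \<and>
     (\<forall>a\<in>S. \<forall>b\<in>S. a \<noteq> b \<longrightarrow> is_square (a * b + 1))"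

definition strong_diophantine_pair :: "rat \<Rightarrow> rat \<Rightarrow> bool" where
  "strong_diophantine_pair a b \<longleftrightarrow>
     rational_diophantine_tuple 2 {a, b} \<and>
     is_square (a\<^sup>2 + 1) \<and> is_square (b\<^sup>2 + 1)"

definition contains_strong_diophantine_pair :: "rat set \<Rightarrow> bool" where
  "contains_strong_diophantine_pair S \<longleftrightarrow>
     (\<exists>a\<in>S. \<exists>b\<in>S. strong_diophantine_pair a b)"

end

theory Submission
  imports Defs "HOL-Computational_Algebra.Polynomial"
begin

text \<open>
  For a rational Diophantine triple \<open>a, b, c\<close> with \<open>w = a b c\<close>, \<open>a b + 1 = r\<^sup>2\<close>,
  \<open>a c + 1 = s\<^sup>2\<close>, \<open>b c + 1 = t\<^sup>2\<close>, consider the elliptic curve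
  \<open>y\<^sup>2 = (a x + 1) (b x + 1) (c x + 1)\<close> with the points \<open>P = (0, 1)\<close> and
  \<open>S = (1/w, r s t/w)\<close>. If \<open>r s + s t + t r = 0\<close> then \<open>S\<close> has order 3, and
  for a point \<open>T\<close> whose \<open>x\<close>-coordinate extends the triple, the numbers \<open>x(T)\<close>, \<open>x(T + S)\<close>,
  \<open>x(T - S)\<close> extend it to a sextuple, up to finitely many exceptions: the line through \<open>T\<close> and
  \<open>S\<close> meets \<open>x = 0\<close> in a point whose ordinate squared is \<open>x(T) x(T + S) + 1\<close>.

  The triple \<open>27209/1760, 10200/1001, 1881/14560\<close> satisfies the condition, and its last two
  elements form a strong pair. So it is enough to find infinitely many \<open>T\<close> for this
  one triple. The map \<open>T \<mapsto> 2 T - P\<close> preserves the points that extend the triple, and it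
  doubles the 2-adically small local parameter \<open>x\<close> near its fixed point \<open>P\<close>, so that the 2-adic
  valuation of \<open>x\<close> grows by exactly 1 in each step and the iterates are pairwise different.
\<close>

section \<open>Polynomial identities for chords and doubling\<close>

text \<open>A cubic minus the square of a line through two of its curve points is monic with the
  known roots \<open>X\<close> and 1; the coefficient of \<open>x\<^sup>2\<close> then forces the
  third root \<open>Xe\<close>.\<close>

lemma chord_identity:
  fixes u1 u2 u3 R X Y m x Xe :: rat
  assumes Y: "Y\<^sup>2 = (X + u1) * (X + u2) * (X + u3)"
    and R: "R\<^sup>2 = (1 + u1) * (1 + u2) * (1 + u3)"
    and X: "X \<noteq> 1" and m: "m = (Y - R) / (X - 1)"
    and Xe: "Xe = m\<^sup>2 - (u1 + u2 + u3) - X - 1"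
  shows "(x + u1) * (x + u2) * (x + u3) - (R + m * (x - 1))\<^sup>2 = (x - X) * (x - 1) * (x - Xe)"
proof -
  have m': "m * (X - 1) = Y - R"
    using X m by simp
  have "(X - 1) * ((x + u1) * (x + u2) * (x + u3) - (R + m * (x - 1))\<^sup>2
      - (x - X) * (x - 1) * (x - Xe)) = 0"
    using Y R m' unfolding Xe by algebra
  then show ?thesis using X by simp
qed

text \<open>
  The points \<open>T\<close> (counted twice), \<open>P - 2 T\<close> and \<open>- P\<close> lie on a parabola
  \<open>y = - 1 + v x + u x\<^sup>2\<close>; here \<open>A = 2 y z\<^sup>2 u\<close> and \<open>B = 2 y z v\<close> for \<open>T = (z, y)\<close>, and
  the \<open>x\<close>-coordinate of \<open>2 T - P\<close> is \<open>4 y z (B + s1 y z) / A\<^sup>2\<close>.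
\<close>

lemma doubling_identity:
  fixes a b c y z :: rat
  defines "s1 \<equiv> a + b + c" and "s2 \<equiv> a * b + b * c + c * a" and "s3 \<equiv> a * b * c"
  defines "A \<equiv> s3 * z ^ 3 - s1 * z - 2 - 2 * y"
    and "B \<equiv> 4 + 4 * y + 3 * s1 * z + 2 * s2 * z\<^sup>2 + s3 * z ^ 3"
  assumes "y\<^sup>2 = (a * z + 1) * (b * z + 1) * (c * z + 1)"
  shows "(a * z + 1)\<^sup>2 * (A\<^sup>2 + 4 * a * y * z * (B + s1 * y * z))
     = (A - a * z * B - 2 * a\<^sup>2 * y * z\<^sup>2)\<^sup>2"
  using assms(6) unfolding A_def B_def s1_def s2_def s3_def by algebra

section \<open>Rationals integral at 2, and their units\<close>

definition two_integral :: "rat \<Rightarrow> bool" where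
  "two_integral x \<longleftrightarrow> (\<exists>m n :: int. odd n \<and> x = of_int m / of_int n)"

text \<open>In lowest terms \<open>y\<close> has odd numerator and denominator, so it is 1 or -1
  modulo 4.\<close>

lemma two_integral_sqrt:
  assumes "two_integral x" and "y\<^sup>2 = 1 + 2 * x"
  shows "two_integral ((y - 1) / 4) \<or> two_integral ((- y - 1) / 4)"
proof -
  obtain i j where ij: "odd j" "x = of_int i / of_int j"
    using assms(1) unfolding two_integral_def by auto
  obtain m n where mn: "y = of_int m / of_int n" "n > 0" "coprime m n"
    by (metis quotient_of_coprime quotient_of_denom_pos quotient_of_div surj_pair)
  have "of_int (m\<^sup>2 * j) = (of_int (n\<^sup>2 * (j + 2 * i)) :: rat)"
    using assms(2) mn ij by (auto simp: field_simps power2_eq_square)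
  then have eq: "m\<^sup>2 * j = n\<^sup>2 * (j + 2 * i)"
    by (simp only: of_int_eq_iff)
  have on: "odd n"
  proof
    assume "even n"
    then have "even (m\<^sup>2 * j)" using eq by simp
    with ij(1) have "even m" by simp
    with \<open>even n\<close> mn(3) show False by (meson coprime_common_divisor odd_one)
  qed
  have om: "odd m"
    using arg_cong[OF eq, of even] on ij(1) by simp
  have "4 dvd m - n \<or> 4 dvd - m - n"
    using on om by presburger
  then show ?thesis
  proof
    assume "4 dvd m - n"
    then obtain k where k: "m - n = 4 * k" ..
    have "y - 1 = of_int (m - n) / of_int n"
      using mn by (simp add: diff_divide_distrib)
    then have "(y - 1) / 4 = of_int k / of_int n" unfolding k by simp
    then show ?thesis unfolding two_integral_def using on by blast
  next
    assume "4 dvd - m - n"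
    then obtain k where k: "- m - n = 4 * k" ..
    have "- y - 1 = of_int (- m - n) / of_int n"
      using mn by (simp add: diff_divide_distrib)
    then have "(- y - 1) / 4 = of_int k / of_int n" unfolding k by simp
    then show ?thesis unfolding two_integral_def using on by blast
  qed
qed


lemma two_integral_of_int [simp]: "two_integral (of_int k)"
  unfolding two_integral_def by (rule exI[of _ k], rule exI[of _ 1]) simp

lemma two_integral_numeral [simp]:
  "two_integral 0" "two_integral 1" "two_integral (numeral k)"
  using two_integral_of_int[of 0] two_integral_of_int[of 1] two_integral_of_int[of "numeral k"]
  by simp_all

lemma two_integral_add [simp, intro]:
  assumes "two_integral x" "two_integral y" shows "two_integral (x + y)"
proof -
  obtain m n k l where "odd n" "x = of_int m / of_int n" "odd l" "y = of_int k / of_int l"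
    using assms unfolding two_integral_def by auto
  moreover from this have "n \<noteq> 0" "l \<noteq> 0" by auto
  ultimately have "odd (n * l)" "x + y = of_int (m * l + k * n) / of_int (n * l)"
    by (simp_all add: field_simps)
  then show ?thesis unfolding two_integral_def by blast
qed

lemma two_integral_mult [simp, intro]:
  assumes "two_integral x" "two_integral y" shows "two_integral (x * y)"
proof -
  obtain m n k l where "odd n" "x = of_int m / of_int n" "odd l" "y = of_int k / of_int l"
    using assms unfolding two_integral_def by auto
  then have "odd (n * l)" "x * y = of_int (m * k) / of_int (n * l)"
    by simp_all
  then show ?thesis unfolding two_integral_def by blast
qed

lemma two_integral_diff [simp, intro]:
  assumes "two_integral x" "two_integral y" shows "two_integral (x - y)"
  using two_integral_add[OF assms(1) two_integral_mult[OF two_integral_of_int[of "-1"] assms(2)]]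
  by simp

lemma two_integral_power [simp, intro]: "two_integral x \<Longrightarrow> two_integral (x ^ n)"
  by (induction n) simp_all

definition two_unit :: "rat \<Rightarrow> bool" where
  "two_unit x \<longleftrightarrow> (\<exists>m n :: int. odd m \<and> odd n \<and> x = of_int m / of_int n)"

lemma two_unit_imp_two_integral [simp]: "two_unit x \<Longrightarrow> two_integral x"
  unfolding two_unit_def two_integral_def by blast

lemma two_unit_nonzero: "two_unit x \<Longrightarrow> x \<noteq> 0"
  unfolding two_unit_def by auto

lemma two_unit_mult: "two_unit x \<Longrightarrow> two_unit y \<Longrightarrow> two_unit (x * y)"
  unfolding two_unit_def by (metis even_mult_iff of_int_mult times_divide_times_eq)

lemma two_unit_divide: "two_unit x \<Longrightarrow> two_unit y \<Longrightarrow> two_unit (x / y)"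
  unfolding two_unit_def by (metis even_mult_iff of_int_mult divide_divide_times_eq)

lemma two_unit_one_plus:
  assumes "two_integral x" shows "two_unit (1 + 2 * x)"
proof -
  obtain m n where "odd n" "x = of_int m / of_int n"
    using assms unfolding two_integral_def by auto
  moreover from this have "n \<noteq> 0" by auto
  ultimately have "odd (n + 2 * m)" "1 + 2 * x = of_int (n + 2 * m) / of_int n"
    by (simp_all add: field_simps)
  then show ?thesis unfolding two_unit_def using \<open>odd n\<close> by blast
qed

lemma two_unit_valuation_unique:
  assumes "two_unit x" "two_unit y" "2 ^ j * x = 2 ^ k * y"
  shows "j = k"
proof -
  have main: "j \<ge> k" if u: "two_unit x" "two_unit y" and eq: "2 ^ j * x = 2 ^ k * y" for j k x y
  proof (rule ccontr)
    assume "\<not> j \<ge> k"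
    then obtain i where i: "k = j + Suc i" using less_imp_Suc_add[of j k] by auto
    have "x / y = of_int (2 ^ Suc i)"
      using eq two_unit_nonzero[OF u(2)] unfolding i by (simp add: power_add)
    moreover obtain m n where "odd m" "odd n" "x / y = of_int m / of_int n"
      using two_unit_divide[OF u] unfolding two_unit_def by auto
    moreover from this have "n \<noteq> 0" by auto
    ultimately have "of_int m = (of_int (2 ^ Suc i * n) :: rat)"
      by (simp add: field_simps)
    then have "m = 2 ^ Suc i * n" by (simp only: of_int_eq_iff)
    with \<open>odd m\<close> show False by simp
  qed
  show ?thesis using main[OF assms] main[OF assms(2,1) assms(3)[symmetric]] by simp
qed

section \<open>Iterating the map T -> 2 T - P near P\<close>

text \<open>
  The condition on \<open>y\<close> selects a neighbourhood of \<open>P = (0, 1)\<close> and excludes \<open>- P = (0, -1)\<close>,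
  where \<open>T \<mapsto> 2 T - P\<close> is not close to \<open>P\<close>.
\<close>

definition near_base_point :: "rat \<Rightarrow> rat \<Rightarrow> rat \<Rightarrow> nat \<Rightarrow> rat \<Rightarrow> bool" where
  "near_base_point a b c k z \<longleftrightarrow>
     (\<exists>e y. two_unit e \<and> z = 2 ^ k * e \<and> two_integral ((y - 1) / 4) \<and>
        y\<^sup>2 = (a * z + 1) * (b * z + 1) * (c * z + 1) \<and>
        is_square (a * z + 1) \<and> is_square (b * z + 1) \<and> is_square (c * z + 1))"

text \<open>Writing \<open>z = 8 * h\<close> and \<open>y = 1 + 4 * v\<close> makes \<open>A\<close>
  equal to -4 times a unit and \<open>B + s1 * y * z\<close> equal to 8 times a unit, so
  \<open>z'\<close> is \<open>2 * z\<close> times a unit.\<close>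

lemma near_base_point_step:
  assumes int: "two_integral a" "two_integral b" "two_integral c"
    and k: "k \<ge> 3" and "near_base_point a b c k z"
  obtains z' where "near_base_point a b c (Suc k) z'"
proof -
  obtain e y where e: "two_unit e" and z: "z = 2 ^ k * e"
    and y4: "two_integral ((y - 1) / 4)"
    and y: "y\<^sup>2 = (a * z + 1) * (b * z + 1) * (c * z + 1)"
    using assms(5) unfolding near_base_point_def by auto
  define s1 s2 s3 where s: "s1 = a + b + c" "s2 = a * b + b * c + c * a" "s3 = a * b * c"
  define A where "A = s3 * z ^ 3 - s1 * z - 2 - 2 * y"
  define B where "B = 4 + 4 * y + 3 * s1 * z + 2 * s2 * z\<^sup>2 + s3 * z ^ 3"
  define z' where "z' = 4 * y * z * (B + s1 * y * z) / A\<^sup>2"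
  define h where "h = 2 ^ (k - 3) * e"
  define v where "v = (y - 1) / 4"
  define \<alpha> where "\<alpha> = v + s1 * h - 64 * s3 * h ^ 3"
  define \<beta> where "\<beta> = v + 2 * s1 * h + 2 * v * s1 * h + 8 * s2 * h\<^sup>2 + 32 * s3 * h ^ 3"
  have sint: "two_integral s1" "two_integral s2" "two_integral s3"
    unfolding s using int by auto
  have hint: "two_integral h" unfolding h_def using e by auto
  have vint: "two_integral v" using y4 unfolding v_def .
  have \<alpha>: "two_integral \<alpha>" and \<beta>: "two_integral \<beta>"
    unfolding \<alpha>_def \<beta>_def using sint hint vint by auto
  have zh: "z = 8 * h"
    unfolding z h_def using k power_add[of "2::rat" 3 "k - 3"] by simp
  have yv: "y = 1 + 2 * (2 * v)" unfolding v_def by (simp add: field_simps)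
  have A4: "A = - 4 * (1 + 2 * \<alpha>)"
    unfolding A_def \<alpha>_def zh yv by (simp add: algebra_simps power3_eq_cube)
  have B8: "B + s1 * y * z = 8 * (1 + 2 * \<beta>)"
    unfolding B_def \<beta>_def zh yv by (simp add: algebra_simps power2_eq_square power3_eq_cube)
  define e' where "e' = y * e * (1 + 2 * \<beta>) / ((1 + 2 * \<alpha>) * (1 + 2 * \<alpha>))"
  have yu: "two_unit y" unfolding yv using vint by (intro two_unit_one_plus) auto
  have e': "two_unit e'" unfolding e'_def
    using yu e \<alpha> \<beta> by (intro two_unit_divide two_unit_mult two_unit_one_plus)
  have A0: "A \<noteq> 0" unfolding A4 using two_unit_nonzero[OF two_unit_one_plus[OF \<alpha>]] by simp
  have z': "z' = 2 ^ Suc k * e'"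
  proof -
    have "z' = 4 * y * z * (8 * (1 + 2 * \<beta>)) / (- 4 * (1 + 2 * \<alpha>))\<^sup>2"
      unfolding z'_def A4 B8 ..
    also have "4 * y * z * (8 * p) / (- 4 * q)\<^sup>2 = 2 * z * (y * p / (q * q))" for p q
      by (simp add: power2_eq_square)
    finally show ?thesis unfolding e'_def z by simp
  qed
  have sq: "is_square (p * z' + 1)"
    if pint: "two_integral p"
      and "(p * z + 1)\<^sup>2 * (A\<^sup>2 + 4 * p * y * z * (B + s1 * y * z))
           = (A - p * z * B - 2 * p\<^sup>2 * y * z\<^sup>2)\<^sup>2" for p
  proof -
    have "p * z + 1 = 1 + 2 * (4 * p * h)" unfolding zh by simp
    then have "p * z + 1 \<noteq> 0"
      using two_unit_nonzero[OF two_unit_one_plus, of "4 * p * h"] pint hint by auto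
    moreover have "p * z' + 1 = (A\<^sup>2 + 4 * p * y * z * (B + s1 * y * z)) / A\<^sup>2"
      unfolding z'_def using A0 by (simp add: field_simps)
    ultimately have "p * z' + 1 = ((A - p * z * B - 2 * p\<^sup>2 * y * z\<^sup>2) / (A * (p * z + 1)))\<^sup>2"
      unfolding power_divide power_mult_distrib that(2)[symmetric] by simp
    then show ?thesis unfolding is_nth_power_def by blast
  qed
  \<comment> \<open>\<open>doubling_identity\<close> singles out its first coefficient; cyclic
    rotation gives the other two.\<close>
  have sqs: "is_square (a * z' + 1)" "is_square (b * z' + 1)" "is_square (c * z' + 1)"
    using doubling_identity[of y a z b c] doubling_identity[of y b z c a]
      doubling_identity[of y c z a b] y int
    by (intro sq; simp add: A_def B_def s algebra_simps)+
  then obtain i j l where "a * z' + 1 = i\<^sup>2" "b * z' + 1 = j\<^sup>2" "c * z' + 1 = l\<^sup>2"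
    unfolding is_nth_power_def by blast
  then have y2: "(i * j * l)\<^sup>2 = (a * z' + 1) * (b * z' + 1) * (c * z' + 1)"
    by (simp add: power_mult_distrib)
  define h' where "h' = 2 ^ k * e'"
  have "two_integral h'" unfolding h'_def using e' by auto
  have "(i * j * l)\<^sup>2 = 1 + 2 * (s1 * h' + 2 * s2 * h'\<^sup>2 + 4 * s3 * h' ^ 3)"
    unfolding y2 z' s h'_def by (simp add: algebra_simps power2_eq_square power3_eq_cube)
  moreover have "two_integral (s1 * h' + 2 * s2 * h'\<^sup>2 + 4 * s3 * h' ^ 3)"
    using sint \<open>two_integral h'\<close> by auto
  \<comment> \<open>The sign of the root is chosen so that the new point is again near P and not
    near -P.\<close>
  ultimately obtain y' where "y'\<^sup>2 = (i * j * l)\<^sup>2" "two_integral ((y' - 1) / 4)"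
    using two_integral_sqrt[of _ "i * j * l"] by (metis power2_minus)
  then have "near_base_point a b c (Suc k) z'"
    unfolding near_base_point_def using e' z' y2 sqs by auto
  then show ?thesis ..
qed

lemma infinite_near_base_point:
  assumes int: "two_integral a" "two_integral b" "two_integral c"
    and k: "k \<ge> 3" and "near_base_point a b c k z"
  shows "infinite {z. \<exists>k\<ge>3. near_base_point a b c k z}"
proof -
  have "\<exists>z. near_base_point a b c (k + n) z" for n
  proof (induction n)
    case 0
    then show ?case using assms(5) by auto
  next
    case (Suc n)
    then show ?case using near_base_point_step[OF int, of "k + n"] k by auto
  qed
  then obtain f where f: "\<And>n. near_base_point a b c (k + n) (f n)" by metis
  have "inj f"
  proof (rule injI)
    fix m n assume "f m = f n"
    then show "m = n"
      using f[of m] f[of n] two_unit_valuation_unique[of _ _ "k + m" "k + n"]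
      unfolding near_base_point_def by auto
  qed
  moreover have "range f \<subseteq> {z. \<exists>k\<ge>3. near_base_point a b c k z}"
    using f k by (auto intro: trans_le_add1)
  ultimately show ?thesis
    using finite_subset range_inj_infinite by blast
qed


section \<open>Sextuples from a triple whose curve has a 3-torsion point\<close>

lemma finite_quadratic_roots:
  fixes k l m :: rat
  assumes "k \<noteq> 0"
  shows "finite {x. k * x\<^sup>2 + l * x + m = 0}"
proof -
  have "finite {x. poly [:m, l, k:] x = 0}"
    using assms by (intro poly_roots_finite) simp
  then show ?thesis by (simp add: algebra_simps power2_eq_square)
qed

lemma finite_monic_quartic_roots:
  fixes c0 c1 c2 c3 :: rat
  shows "finite {x. x ^ 4 + c3 * x ^ 3 + c2 * x\<^sup>2 + c1 * x + c0 = 0}"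
proof -
  have "finite {x. poly [:c0, c1, c2, c3, 1:] x = 0}"
    by (intro poly_roots_finite) simp
  then show ?thesis by (simp add: algebra_simps power2_eq_square power3_eq_cube power4_eq_xxxx)
qed

lemma is_squareI: "x = y\<^sup>2 \<Longrightarrow> is_square x"
  unfolding is_nth_power_def by blast

text \<open>\<open>flex\<close> makes S an inflection point; \<open>not_S\<close> keeps the abscissa
  of S away from the triple itself.\<close>

locale order_three_triple =
  fixes a b c r s t :: rat
  assumes nonzero: "a \<noteq> 0" "b \<noteq> 0" "c \<noteq> 0" "r \<noteq> 0" "s \<noteq> 0" "t \<noteq> 0"
    and distinct: "a \<noteq> b" "a \<noteq> c" "b \<noteq> c"
    and ab: "a * b + 1 = r\<^sup>2" and ac: "a * c + 1 = s\<^sup>2" and bc: "b * c + 1 = t\<^sup>2"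
    and flex: "r * s + s * t + t * r = 0"
    and not_S: "a * b * c * a \<noteq> 1" "a * b * c * b \<noteq> 1" "a * b * c * c \<noteq> 1"
begin

definition "w = a * b * c"
definition "p = r + s + t"
definition "g = p + r * s * t"

lemma w_nonzero: "w \<noteq> 0"
  unfolding w_def using nonzero by simp

text \<open>
  With \<open>X = w x\<close> and \<open>Y = w y\<close> the curve becomes \<open>Y\<^sup>2 = (X + a b) (X + a c) (X + b c)\<close>, the
  point \<open>S\<close> becomes \<open>(1, r s t)\<close>, and \<open>flex\<close> makes all coefficients polynomials in \<open>p\<close> and \<open>g\<close>.
\<close>

lemma sigma2: "a * b + a * c + b * c = p\<^sup>2 - 3"
  using ab ac bc flex unfolding p_def by algebra

lemma w_square: "w\<^sup>2 = g\<^sup>2 - 1"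
  using ab ac bc flex unfolding p_def g_def w_def by algebra

lemma w_sigma1: "w * (a + b + c) = 3 - 2 * p * g"
  using ab ac bc flex unfolding p_def g_def w_def by algebra

text \<open>The right side is \<open>(X - 1) ^ 3 + (p * X - g)\<^sup>2\<close>, so
  \<open>Y = g - p * X\<close> is the inflectional tangent at S.\<close>

lemma curve: "(X + a * b) * (X + a * c) * (X + b * c)
    = X ^ 3 + (p\<^sup>2 - 3) * X\<^sup>2 + (3 - 2 * p * g) * X + (g\<^sup>2 - 1)"
  unfolding w_square[symmetric] w_sigma1[symmetric] sigma2[symmetric] w_def
  by (simp add: algebra_simps power2_eq_square power3_eq_cube)

text \<open>
  \<open>shift X Y\<close> and \<open>shift X (- Y)\<close> are the \<open>X\<close>-coordinates of \<open>T + S\<close> and \<open>T - S\<close> for \<open>T = (X, Y)\<close>.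
\<close>

definition "shift X Y = ((Y - r * s * t) / (X - 1))\<^sup>2 - (p\<^sup>2 - 3) - X - 1"

lemma shift_chord:
  assumes "Y\<^sup>2 = (X + a * b) * (X + a * c) * (X + b * c)" "X \<noteq> 1"
  obtains m where "\<And>x. (x + a * b) * (x + a * c) * (x + b * c) - (r * s * t + m * (x - 1))\<^sup>2
       = (x - X) * (x - 1) * (x - shift X Y)"
proof -
  have "(r * s * t)\<^sup>2 = (1 + a * b) * (1 + a * c) * (1 + b * c)"
    using ab ac bc by (simp add: power_mult_distrib add.commute)
  from chord_identity[OF assms(1) this assms(2) refl refl]
  show ?thesis using that unfolding shift_def sigma2[symmetric] by (metis (no_types))
qed

text \<open>The chord identity is evaluated at 0, where the cubic is \<open>w\<^sup>2\<close>, and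
  at each root \<open>- v\<close> of the cubic, where it leaves
  \<open>(X + v) * (v + 1) * (shift X Y + v)\<close> a square.\<close>

lemma shift_square:
  assumes Y: "Y\<^sup>2 = (X + a * b) * (X + a * c) * (X + b * c)" "X \<noteq> 1"
  shows "is_square (X * shift X Y / w\<^sup>2 + 1)"
    and "\<lbrakk>is_square (a * (X / w) + 1); X \<noteq> - b * c\<rbrakk> \<Longrightarrow> is_square (a * (shift X Y / w) + 1)"
    and "\<lbrakk>is_square (b * (X / w) + 1); X \<noteq> - a * c\<rbrakk> \<Longrightarrow> is_square (b * (shift X Y / w) + 1)"
    and "\<lbrakk>is_square (c * (X / w) + 1); X \<noteq> - a * b\<rbrakk> \<Longrightarrow> is_square (c * (shift X Y / w) + 1)"
proof -
  obtain m where chord: "\<And>x. (x + a * b) * (x + a * c) * (x + b * c) - (r * s * t + m * (x - 1))\<^sup>2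
       = (x - X) * (x - 1) * (x - shift X Y)"
    using shift_chord[OF Y] by metis
  have "w\<^sup>2 + X * shift X Y = (r * s * t - m)\<^sup>2"
    using chord[of 0] unfolding w_def by (simp add: algebra_simps power2_eq_square)
  then have "X * shift X Y / w\<^sup>2 + 1 = ((r * s * t - m) / w)\<^sup>2"
    using w_nonzero by (simp add: field_simps)
  then show "is_square (X * shift X Y / w\<^sup>2 + 1)" by (rule is_squareI)
  have factor: "is_square (u * (shift X Y / w) + 1)"
    if u: "is_square (u * (X / w) + 1)" and Xv: "X \<noteq> - v" and uv: "u * v = w" "u \<noteq> 0" "v \<noteq> 0" "q \<noteq> 0"
      and q: "v + 1 = q\<^sup>2"
      and root: "(- v + a * b) * (- v + a * c) * (- v + b * c) = 0" for u v q
  proof -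
    obtain k where k: "u * (X / w) + 1 = k\<^sup>2"
      using u unfolding is_nth_power_def by blast
    have quot: "u * (x / w) + 1 = (x + v) / v" for x
      unfolding uv(1)[symmetric] using uv(2,3) by (simp add: add_divide_distrib)
    have Xk: "X + v = k\<^sup>2 * v" using k \<open>v \<noteq> 0\<close> unfolding quot by (simp add: field_simps)
    then have "k \<noteq> 0" using Xv by auto
    have "(X + v) * (v + 1) * (shift X Y + v) = (r * s * t - m * (v + 1))\<^sup>2"
      using chord[of "- v"] unfolding root by (simp add: algebra_simps power2_eq_square)
    then have "(k * q)\<^sup>2 * v * (shift X Y + v) = (r * s * t - m * (v + 1))\<^sup>2"
      unfolding Xk q by (simp add: power_mult_distrib mult_ac)
    then have "(shift X Y + v) / v = ((r * s * t - m * (v + 1)) / (k * q * v))\<^sup>2"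
      using \<open>k \<noteq> 0\<close> \<open>q \<noteq> 0\<close> \<open>v \<noteq> 0\<close>
      by (simp add: power_divide power_mult_distrib divide_simps) (simp add: power2_eq_square mult_ac)
    then show ?thesis unfolding quot by (rule is_squareI)
  qed
  show "is_square (a * (shift X Y / w) + 1)" if "is_square (a * (X / w) + 1)" "X \<noteq> - b * c"
    using factor[of a "b * c" t] that nonzero bc by (simp add: w_def)
  show "is_square (b * (shift X Y / w) + 1)" if "is_square (b * (X / w) + 1)" "X \<noteq> - a * c"
    using factor[of b "a * c" s] that nonzero ac by (simp add: w_def)
  show "is_square (c * (shift X Y / w) + 1)" if "is_square (c * (X / w) + 1)" "X \<noteq> - a * b"
    using factor[of c "a * b" r] that nonzero ab by (simp add: w_def)
qed

definition "shift_sum X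
  = 2 * (X * (X + 1) + 2 * (p\<^sup>2 - 3) * X + (3 - 2 * p * g) * (X + 1) + 2 * (g\<^sup>2 - 1))"
definition "shift_prod X
  = (X - (3 - 2 * p * g))\<^sup>2 - 4 * (g\<^sup>2 - 1) * (X + p\<^sup>2 - 2)"

lemma shift_vieta:
  assumes Y: "Y\<^sup>2 = (X + a * b) * (X + a * c) * (X + b * c)" "X \<noteq> 1"
  shows "(X - 1)\<^sup>2 * (shift X Y + shift X (- Y)) = shift_sum X"
    and "(X - 1)\<^sup>2 * (shift X Y * shift X (- Y)) = shift_prod X"
proof -
  define m n where "m = (Y - r * s * t) / (X - 1)" and "n = (- Y - r * s * t) / (X - 1)"
  have m: "m * (X - 1) = Y - (g - p)" "n * (X - 1) = - Y - (g - p)"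
    unfolding m_def n_def g_def using Y(2) by simp_all
  have sh: "shift X Y = m\<^sup>2 - (p\<^sup>2 - 3) - X - 1" "shift X (- Y) = n\<^sup>2 - (p\<^sup>2 - 3) - X - 1"
    unfolding shift_def m_def n_def by simp_all
  note Y' = Y(1)[unfolded curve]
  show "(X - 1)\<^sup>2 * (shift X Y + shift X (- Y)) = shift_sum X"
    using m Y' unfolding sh shift_sum_def by algebra
  \<comment> \<open>Two squared slopes bring the denominator \<open>(X - 1) ^ 4\<close>, hence the
    extra factor that is cancelled afterwards.\<close>
  have "(X - 1)\<^sup>2 * ((X - 1)\<^sup>2 * (shift X Y * shift X (- Y)) - shift_prod X) = 0"
    using m Y' unfolding sh shift_prod_def by algebra
  then show "(X - 1)\<^sup>2 * (shift X Y * shift X (- Y)) = shift_prod X"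
    using Y(2) by simp
qed

lemma shift_prod_square: "shift_prod X + w\<^sup>2 * (X - 1)\<^sup>2 = (g * X - (3 * g - 2 * p))\<^sup>2"
  unfolding shift_prod_def w_square by algebra

text \<open>As 3 S = 0, the points T - S and -S add up to T + S, so a chord again lies behind this
  square; \<open>shift_prod_square\<close> gives it explicitly.\<close>

lemma shift_pair_square:
  assumes Y: "Y\<^sup>2 = (X + a * b) * (X + a * c) * (X + b * c)" "X \<noteq> 1"
  shows "is_square (shift X Y / w * (shift X (- Y) / w) + 1)"
proof -
  have "(w * (X - 1))\<^sup>2 * (shift X Y / w * (shift X (- Y) / w) + 1)
      = (X - 1)\<^sup>2 * (shift X Y * shift X (- Y)) + w\<^sup>2 * (X - 1)\<^sup>2"
    using w_nonzero by (simp add: field_simps power2_eq_square)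
  also have "\<dots> = (g * X - (3 * g - 2 * p))\<^sup>2"
    unfolding shift_vieta[OF Y] shift_prod_square ..
  finally have "shift X Y / w * (shift X (- Y) / w) + 1
      = ((g * X - (3 * g - 2 * p)) / (w * (X - 1)))\<^sup>2"
    using w_nonzero Y(2) by (simp add: power_divide eq_divide_eq mult.commute)
  then show ?thesis by (rule is_squareI)
qed

text \<open>
  The last two families of equations express that \<open>T + S\<close> or \<open>T - S\<close> has \<open>X\<close>-coordinate \<open>V\<close>,
  respectively the same \<open>X\<close>-coordinate as \<open>T\<close>.
\<close>

definition "exceptional = {1, 0, w * a, w * b, w * c, - b * c, - a * c, - a * b}
  \<union> (\<Union>V \<in> {0, w * a, w * b, w * c}. {X. shift_prod X - V * shift_sum X + V\<^sup>2 * (X - 1)\<^sup>2 = 0})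
  \<union> {X. shift_prod X - X * shift_sum X + X\<^sup>2 * (X - 1)\<^sup>2 = 0}"

text \<open>The quadratics have leading coefficient \<open>(V - 1)\<^sup>2\<close>, nonzero by
  \<open>not_S\<close> (or because \<open>V\<close> is 0), and the last equation is a monic
  quartic.\<close>

lemma finite_exceptional: "finite exceptional"
proof -
  have quad: "finite {X. shift_prod X - V * shift_sum X + V\<^sup>2 * (X - 1)\<^sup>2 = 0}" if "V \<noteq> 1" for V
  proof -
    have "\<exists>l m. \<forall>X. shift_prod X - V * shift_sum X + V\<^sup>2 * (X - 1)\<^sup>2 = (V - 1)\<^sup>2 * X\<^sup>2 + l * X + m"
    proof (intro exI allI)
      fix X
      show "shift_prod X - V * shift_sum X + V\<^sup>2 * (X - 1)\<^sup>2 = (V - 1)\<^sup>2 * X\<^sup>2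
        + (- 2 * (3 - 2 * p * g) - 4 * (g\<^sup>2 - 1) - 2 * V * (1 + 2 * (p\<^sup>2 - 3) + (3 - 2 * p * g)) - 2 * V\<^sup>2) * X
        + ((3 - 2 * p * g)\<^sup>2 - 4 * (g\<^sup>2 - 1) * (p\<^sup>2 - 2) - 2 * V * (3 - 2 * p * g + 2 * (g\<^sup>2 - 1)) + V\<^sup>2)"
        unfolding shift_prod_def shift_sum_def by algebra
    qed
    then show ?thesis using finite_quadratic_roots[of "(V - 1)\<^sup>2"] that by auto
  qed
  have quart: "finite {X. shift_prod X - X * shift_sum X + X\<^sup>2 * (X - 1)\<^sup>2 = 0}"
  proof -
    have "shift_prod X - X * shift_sum X + X\<^sup>2 * (X - 1)\<^sup>2
      = X ^ 4 + (- 4) * X ^ 3 + (- 4 * (p\<^sup>2 - 3) - 2 * (3 - 2 * p * g)) * X\<^sup>2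
        + (- 4 * (3 - 2 * p * g) - 8 * (g\<^sup>2 - 1)) * X
        + ((3 - 2 * p * g)\<^sup>2 - 4 * (g\<^sup>2 - 1) * (p\<^sup>2 - 2))" for X
      unfolding shift_prod_def shift_sum_def by algebra
    then show ?thesis by (simp only: finite_monic_quartic_roots)
  qed
  show ?thesis unfolding exceptional_def
    by (intro finite_UnI finite_UN_I quad quart) (use not_S in \<open>auto simp: w_def\<close>)
qed

lemma sextuple:
  assumes d: "y\<^sup>2 = (a * d + 1) * (b * d + 1) * (c * d + 1)"
    and sq: "is_square (a * d + 1)" "is_square (b * d + 1)" "is_square (c * d + 1)"
    and good: "w * d \<notin> exceptional"
  obtains e f where "rational_diophantine_tuple 6 {a, b, c, d, e, f}"
proof -
  define X Y where "X = w * d" and "Y = w * y"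
  have dX: "d = X / w" unfolding X_def using w_nonzero by simp
  have Y: "Y\<^sup>2 = (X + a * b) * (X + a * c) * (X + b * c)"
    unfolding Y_def X_def w_def power_mult_distrib d by algebra
  have X: "X \<noteq> 1" "X \<noteq> 0" "X \<noteq> w * a" "X \<noteq> w * b" "X \<noteq> w * c"
      "X \<noteq> - b * c" "X \<noteq> - a * c" "X \<noteq> - a * b"
    using good unfolding exceptional_def X_def by auto
  have Y': "(- Y)\<^sup>2 = (X + a * b) * (X + a * c) * (X + b * c)" using Y by simp
  define e f where "e = shift X Y / w" and "f = shift X (- Y) / w"
  have avoid: "shift X Y \<noteq> V \<and> shift X (- Y) \<noteq> V" if "V \<in> {X, 0, w * a, w * b, w * c}" for V
  proof -
    \<comment> \<open>By Vieta, the equations in \<open>exceptional\<close> factor over the two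
      shifted abscissas.\<close>
    have "shift_prod X - V * shift_sum X + V\<^sup>2 * (X - 1)\<^sup>2
        = (X - 1)\<^sup>2 * ((shift X Y - V) * (shift X (- Y) - V))"
      unfolding shift_vieta[OF Y X(1), symmetric] by algebra
    moreover have "shift_prod X - V * shift_sum X + V\<^sup>2 * (X - 1)\<^sup>2 \<noteq> 0"
      using that good unfolding exceptional_def X_def[symmetric] by auto
    ultimately show ?thesis by auto
  qed
  \<comment> \<open>T + S and T - S share an abscissa only if \<open>Y\<close> vanishes, that is, if
    T has order 2.\<close>
  have "(X - 1)\<^sup>2 * (shift X (- Y) - shift X Y) = 4 * Y * (r * s * t)"
  proof -
    have cancel: "(X - 1)\<^sup>2 * (u / (X - 1))\<^sup>2 = u\<^sup>2" for u
      using X(1) by (simp add: power_divide)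
    show ?thesis
      using cancel[of "Y - r * s * t"] cancel[of "- Y - r * s * t"] unfolding shift_def by algebra
  qed
  moreover have "Y \<noteq> 0"
    using Y X by (auto simp: add_eq_0_iff2)
  ultimately have ne: "shift X (- Y) \<noteq> shift X Y" using nonzero by auto
  have neq: "e \<noteq> v \<and> f \<noteq> v" if "v \<in> {d, 0, a, b, c}" for v
  proof -
    have "w * v \<in> {X, 0, w * a, w * b, w * c}" using that unfolding X_def by auto
    from avoid[OF this] show ?thesis
      using w_nonzero unfolding e_def f_def by (simp add: divide_eq_eq mult.commute)
  qed
  have neqs: "e \<notin> {d, 0, a, b, c}" "f \<notin> {d, 0, a, b, c}"
    using neq by blast+
  have dist: "e \<noteq> f" "d \<noteq> a" "d \<noteq> b" "d \<noteq> c" "d \<noteq> 0"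
    using ne X w_nonzero unfolding e_def f_def dX by (auto simp: field_simps)
  have se: "is_square (d * e + 1)" "is_square (a * e + 1)" "is_square (b * e + 1)" "is_square (c * e + 1)"
    using shift_square[OF Y X(1)] sq X unfolding e_def dX by (simp_all add: power2_eq_square)
  have sf: "is_square (d * f + 1)" "is_square (a * f + 1)" "is_square (b * f + 1)" "is_square (c * f + 1)"
    using shift_square[OF Y' X(1)] sq X unfolding f_def dX by (simp_all add: power2_eq_square)
  have sef: "is_square (e * f + 1)"
    using shift_pair_square[OF Y X(1)] unfolding e_def f_def .
  have "a \<notin> {b, c, d, e, f}" "b \<notin> {c, d, e, f}" "c \<notin> {d, e, f}" "d \<notin> {e, f}" "e \<notin> {f}"
    using distinct dist neqs by blast+
  then have "card {a, b, c, d, e, f} = 6" by simp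
  moreover have "\<forall>x \<in> {a, b, c, d, e, f}. \<forall>z \<in> {a, b, c, d, e, f}. x \<noteq> z \<longrightarrow> is_square (x * z + 1)"
    using sq se sf sef ab ac bc by (auto simp: mult.commute)
  moreover have "0 \<notin> {a, b, c, d, e, f}"
    using nonzero dist neqs by auto
  ultimately show ?thesis
    using that unfolding rational_diophantine_tuple_def by blast
qed

end


section \<open>The explicit triple and its starting point\<close>

text \<open>
  The arguments of \<open>near_base_point\<close> are the triple multiplied by 32, which makes it 2-integral;
  accordingly the extending elements are \<open>32 z\<close>.
\<close>

lemma near_base_point_start: "near_base_point (27209/55) (326400/1001) (1881/455) 3 (2968/715)"
proof -
  have "two_unit (371/715)"
    unfolding two_unit_def by (rule exI[of _ 371], rule exI[of _ 715]) simp
  \<comment> \<open>The ordinate is minus the product of the three square roots below; this sign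
    makes it 1 modulo 4.\<close>
  moreover have "two_integral ((- 3634422543/511225 - 1) / 4)"
    unfolding two_integral_def by (rule exI[of _ "- 908733442"], rule exI[of _ 511225]) simp
  moreover have "is_square ((27209/55) * (2968/715) + 1 :: rat)"
    by (rule is_squareI[of _ "2493/55"]) (simp add: power2_eq_square)
  moreover have "is_square ((326400/1001) * (2968/715) + 1 :: rat)"
    by (rule is_squareI[of _ "5263/143"]) (simp add: power2_eq_square)
  moreover have "is_square ((1881/455) * (2968/715) + 1 :: rat)"
    by (rule is_squareI[of _ "277/65"]) (simp add: power2_eq_square)
  ultimately show ?thesis
    unfolding near_base_point_def
    by (intro exI[of _ "371/715"] exI[of _ "- 3634422543/511225"]) (simp add: power2_eq_square)
qed

text \<open>\<open>flex\<close> says that the reciprocals of \<open>r\<close>, \<open>s\<close>,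
  \<open>t\<close> sum to 0; here this is 22 + 160 - 182 = 0, which dictates the negative
  \<open>t\<close>.\<close>

interpretation order_three_triple
  "27209/1760" "10200/1001" "1881/14560" "277/22" "277/160" "- 277/182"
  by unfold_locales (simp_all add: power2_eq_square)

lemma strong_pair: "strong_diophantine_pair (10200/1001) (1881/14560)"
proof -
  have "is_square ((10200/1001) * (1881/14560) + 1 :: rat)"
    by (rule is_squareI[of _ "277/182"]) (simp add: power2_eq_square)
  moreover have "is_square ((10200/1001)\<^sup>2 + 1 :: rat)"
    by (rule is_squareI[of _ "10249/1001"]) (simp add: power2_eq_square)
  moreover have "is_square ((1881/14560)\<^sup>2 + 1 :: rat)"
    by (rule is_squareI[of _ "14681/14560"]) (simp add: power2_eq_square)
  ultimately show ?thesis
    unfolding strong_diophantine_pair_def rational_diophantine_tuple_def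
    by (simp add: mult.commute)
qed

theorem theorem2:
  shows "infinite {S :: rat set. rational_diophantine_tuple 6 S \<and>
                                 contains_strong_diophantine_pair S}"
proof
  let ?F = "{S :: rat set. rational_diophantine_tuple 6 S \<and> contains_strong_diophantine_pair S}"
  let ?Z = "{z. \<exists>k\<ge>3. near_base_point (27209/55) (326400/1001) (1881/455) k z}"
  assume fin: "finite ?F"
  have int: "two_integral (27209/55)" "two_integral (326400/1001)" "two_integral (1881/455)"
    unfolding two_integral_def
    by (rule exI[of _ 27209], rule exI[of _ 55], simp,
        rule exI[of _ 326400], rule exI[of _ 1001], simp,
        rule exI[of _ 1881], rule exI[of _ 455], simp)
  have "infinite ?Z"
    by (rule infinite_near_base_point[OF int _ near_base_point_start]) simp
  \<comment> \<open>Different \<open>z\<close> may yield the same sextuple, so elements are counted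
    instead: finitely many sextuples have a finite union, which cannot absorb all but finitely many
    \<open>32 * z\<close>.\<close>
  moreover have "?Z \<subseteq> (\<lambda>x. x / (32 * w)) ` exceptional \<union> (\<lambda>x. x / 32) ` \<Union> ?F"
  proof
    fix z assume "z \<in> ?Z"
    then obtain y where y: "y\<^sup>2 = (27209/55 * z + 1) * (326400/1001 * z + 1) * (1881/455 * z + 1)"
      and sq: "is_square (27209/55 * z + 1)" "is_square (326400/1001 * z + 1)"
        "is_square (1881/455 * z + 1)"
      unfolding near_base_point_def by blast
    show "z \<in> (\<lambda>x. x / (32 * w)) ` exceptional \<union> (\<lambda>x. x / 32) ` \<Union> ?F"
    proof (cases "w * (32 * z) \<in> exceptional")
      case True
      then have "w * (32 * z) / (32 * w) \<in> (\<lambda>x. x / (32 * w)) ` exceptional" by (rule imageI)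
      then show ?thesis using w_nonzero by simp
    next
      case False
      have "y\<^sup>2 = (27209/1760 * (32 * z) + 1) * (10200/1001 * (32 * z) + 1) * (1881/14560 * (32 * z) + 1)"
        "is_square (27209/1760 * (32 * z) + 1)" "is_square (10200/1001 * (32 * z) + 1)"
        "is_square (1881/14560 * (32 * z) + 1)"
        using y sq by simp_all
      from sextuple[OF this False] obtain e f where
        "rational_diophantine_tuple 6 {27209/1760, 10200/1001, 1881/14560, 32 * z, e, f}" .
      then have "{27209/1760, 10200/1001, 1881/14560, 32 * z, e, f} \<in> ?F"
        using strong_pair unfolding contains_strong_diophantine_pair_def by blast
      then have "32 * z \<in> \<Union> ?F" by blast
      then have "32 * z / 32 \<in> (\<lambda>x. x / 32) ` \<Union> ?F" by (rule imageI)
      then show ?thesis by simp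
    qed
  qed
  moreover have "finite S" if "S \<in> ?F" for S
    using that unfolding rational_diophantine_tuple_def by simp
  then have "finite (\<Union> ?F)" using fin by blast
  ultimately show False
    using finite_exceptional finite_subset by blast
qed

end
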